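(* Let $X_1,X_2,\dots$ be independent $\mathbb{R}^n_+$-valued random variables, each with distribution $\mu\in\mathcal{P}_1^+$, and let $$\widehat{\mu}_N=\frac{1}{N}\sum_{i=1}^N\delta_{X_i}$$ be the empirical measure. Then, with probability 1, $Z(\widehat{\mu}_N)\to Z(\mu)$ in the Hausdorff metric $d_H$ as $N\to\infty$.
   Context: $\mathbb{R}^n_+=\{x\in\mathbb{R}^n : x\ge 0\}$ (componentwise inequality). $\mathcal{P}_1^+$ is the set of Borel probability measures on $\mathbb{R}^n$ with support contained in $\mathbb{R}^n_+$ and finite first moment. $\delta_x$ is the Dirac measure at $x$. For a finite non-negative Borel measure $\mu$ on $\mathbb{R}^n$ with finite first moment, the zonoid of $\mu$ is $$Z(\mu)=\left\{\int_{\mathbb{R}^n}\phi(x)\,x\,d\mu(x)\ :\ \phi\colon\mathbb{R}^n\to[0,1]\text{ measurable}\right\},$$ a compact convex subset of $\mathbb{R}^n$ (integrals componentwise). The Hausdorff metric on non-empty compact convex sets is $$d_H(K,L)=\min\{\epsilon\ge 0 : K\subseteq L+\epsilon B^n,\ L\subseteq K+\epsilon B^n\},$$ with $B^n$ the Euclidean unit ball of $\mathbb{R}^n$. *)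

theory Defs
  imports "HOL-Probability.Probability"
begin

definition nonneg_orthant :: "(real ^ 'n) set" where
  "nonneg_orthant = {x. \<forall>i. 0 \<le> x $ i}"

definition measure_support :: "'a::topological_space measure \<Rightarrow> 'a set" where
  "measure_support \<mu> = {x. \<forall>U. open U \<and> x \<in> U \<longrightarrow> 0 < emeasure \<mu> U}"

definition P1_plus :: "(real ^ 'n) measure set" where
  "P1_plus = {\<mu>. prob_space \<mu> \<and> sets \<mu> = sets borel \<and>
                 measure_support \<mu> \<subseteq> nonneg_orthant \<and> integrable \<mu> norm}"

definition zonoid :: "(real ^ 'n) measure \<Rightarrow> (real ^ 'n) set" where
  "zonoid \<mu> = {(\<integral>x. \<phi> x *\<^sub>R x \<partial>\<mu>) | \<phi>. \<phi> \<in> borel_measurable borel \<and> range \<phi> \<subseteq> {0..1::real}}"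

text \<open>The points \<^term>\<open>x\<close> are indexed from 1; \<^term>\<open>return borel a\<close> is the Dirac measure at \<^term>\<open>a\<close>.
  For \<^term>\<open>N = 0\<close> this is the zero measure. Lemma \<open>emeasure_empirical_measure\<close> shows
  that \<^const>\<open>measure_of\<close> does not fall back to its default value here.\<close>

definition empirical_measure :: "(nat \<Rightarrow> real ^ 'n) \<Rightarrow> nat \<Rightarrow> (real ^ 'n) measure" where
  "empirical_measure x N = measure_of UNIV (sets borel)
     (\<lambda>A. ennreal (1 / real N) * (\<Sum>i\<in>{1..N}. emeasure (return borel (x i)) A))"

lemma sets_empirical_measure [simp, measurable_cong]: "sets (empirical_measure x N) = sets borel"
  unfolding empirical_measure_def by (metis sets.sets_measure_of_eq space_borel)

lemma emeasure_empirical_measure: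
  fixes x :: "nat \<Rightarrow> real ^ 'n"
  assumes "A \<in> sets borel"
  shows "emeasure (empirical_measure x N) A
    = ennreal (1 / real N) * (\<Sum>i\<in>{1..N}. emeasure (return borel (x i)) A)"
proof (rule emeasure_measure_of[OF empirical_measure_def])
  show "countably_additive (sets (empirical_measure x N))
     (\<lambda>A. ennreal (1 / real N) * (\<Sum>i\<in>{1..N}. emeasure (return borel (x i)) A))"
  proof (rule countably_additiveI)
    fix F :: "nat \<Rightarrow> (real ^ 'n) set"
    assume F: "range F \<subseteq> sets (empirical_measure x N)" "disjoint_family F"
    have "(\<Sum>k. emeasure (return borel (x i)) (F k)) = emeasure (return borel (x i)) (\<Union>k. F k)" for i
      using F by (intro suminf_emeasure) auto
    then show "(\<Sum>k. ennreal (1 / real N) * (\<Sum>i\<in>{1..N}. emeasure (return borel (x i)) (F k)))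
        = ennreal (1 / real N) * (\<Sum>i\<in>{1..N}. emeasure (return borel (x i)) (\<Union>k. F k))"
      by (simp add: suminf_sum)
  qed
qed (use assms in \<open>auto simp: positive_def\<close>)

text \<open>The infimum is a minimum for non-empty compact sets, see \<open>hausdorff_dist_attained\<close>.\<close>

definition hausdorff_dist :: "'a::euclidean_space set \<Rightarrow> 'a set \<Rightarrow> real" where
  "hausdorff_dist K L = Inf {\<epsilon>. 0 \<le> \<epsilon> \<and>
      K \<subseteq> {y + \<epsilon> *\<^sub>R b | y b. y \<in> L \<and> b \<in> cball 0 1} \<and>
      L \<subseteq> {y + \<epsilon> *\<^sub>R b | y b. y \<in> K \<and> b \<in> cball 0 1}}"

lemma subset_parallel_body_iff:
  fixes K L :: "'a::euclidean_space set"
  assumes L: "compact L" "L \<noteq> {}" and e: "0 \<le> \<epsilon>"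
  shows "K \<subseteq> {y + \<epsilon> *\<^sub>R b | y b. y \<in> L \<and> b \<in> cball 0 1} \<longleftrightarrow> (\<forall>x\<in>K. infdist x L \<le> \<epsilon>)"
proof -
  have "(\<exists>y b. x = y + \<epsilon> *\<^sub>R b \<and> y \<in> L \<and> b \<in> cball 0 1) \<longleftrightarrow> infdist x L \<le> \<epsilon>" for x
  proof
    assume "\<exists>y b. x = y + \<epsilon> *\<^sub>R b \<and> y \<in> L \<and> b \<in> cball 0 1"
    then obtain y b where yb: "x = y + \<epsilon> *\<^sub>R b" "y \<in> L" "norm b \<le> 1" by auto
    have "infdist x L \<le> dist x y" using yb by (intro infdist_le)
    also have "\<dots> \<le> \<epsilon>" using yb e by (simp add: dist_norm mult_left_le)
    finally show "infdist x L \<le> \<epsilon>" .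
  next
    assume a: "infdist x L \<le> \<epsilon>"
    obtain y where y: "y \<in> L" "infdist x L = dist x y"
      using infdist_attains_inf[of L x] L by (auto simp: compact_imp_closed)
    show "\<exists>y b. x = y + \<epsilon> *\<^sub>R b \<and> y \<in> L \<and> b \<in> cball 0 1"
    proof (cases "\<epsilon> = 0")
      case True
      then show ?thesis using y a by (intro exI[of _ y] exI[of _ 0]) auto
    next
      case False
      then show ?thesis using y a e
        by (intro exI[of _ y] exI[of _ "(1 / \<epsilon>) *\<^sub>R (x - y)"]) (auto simp: dist_norm)
    qed
  qed
  then show ?thesis by fast
qed

lemma hausdorff_dist_attained:
  fixes K L :: "'a::euclidean_space set"
  assumes K: "compact K" "K \<noteq> {}" and L: "compact L" "L \<noteq> {}"
  shows "hausdorff_dist K L \<in> {\<epsilon>. 0 \<le> \<epsilon> \<and>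
      K \<subseteq> {y + \<epsilon> *\<^sub>R b | y b. y \<in> L \<and> b \<in> cball 0 1} \<and>
      L \<subseteq> {y + \<epsilon> *\<^sub>R b | y b. y \<in> K \<and> b \<in> cball 0 1}}" (is "_ \<in> ?E")
proof -
  have E: "?E = {0..} \<inter> (\<Inter>x\<in>K. {infdist x L..}) \<inter> (\<Inter>x\<in>L. {infdist x K..})"
  proof (rule set_eqI)
    fix \<epsilon> :: real
    show "\<epsilon> \<in> ?E \<longleftrightarrow> \<epsilon> \<in> {0..} \<inter> (\<Inter>x\<in>K. {infdist x L..}) \<inter> (\<Inter>x\<in>L. {infdist x K..})"
    proof (cases "0 \<le> \<epsilon>")
      case True
      show ?thesis
        unfolding mem_Collect_eq subset_parallel_body_iff[OF L True] subset_parallel_body_iff[OF K True]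
        by auto
    qed simp
  qed
  have "compact ((\<lambda>x. infdist x L) ` K)" "compact ((\<lambda>x. infdist x K) ` L)"
    using K L by (auto intro!: compact_continuous_image continuous_intros)
  then have "bdd_above ((\<lambda>x. infdist x L) ` K)" "bdd_above ((\<lambda>x. infdist x K) ` L)"
    by (auto intro: bounded_imp_bdd_above compact_imp_bounded)
  then obtain a b where "\<forall>x\<in>K. infdist x L \<le> a" "\<forall>x\<in>L. infdist x K \<le> b"
    by (auto simp: bdd_above_def)
  then have "max 0 (max a b) \<in> ?E" unfolding E by (auto simp: le_max_iff_disj)
  moreover have "closed ?E" unfolding E by (intro closed_Int closed_INT ballI closed_atLeast)
  moreover have "bdd_below ?E" by (auto intro: bdd_belowI[of _ 0])
  ultimately show ?thesis
    unfolding hausdorff_dist_def by (metis (no_types, lifting) closed_contains_Inf empty_iff)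
qed

end

theory Submission
  imports Defs
begin

text \<open>
  A zonoid is convex, and its support function is
  \<open>u \<mapsto> \<integral>x. max 0 (x \<bullet> u) \<partial>\<mu>\<close>: a weight \<open>\<phi>\<close> that maximises \<open>(\<integral>x. \<phi> x *\<^sub>R x \<partial>\<mu>) \<bullet> u\<close> is
  the indicator of the half-space \<open>0 < x \<bullet> u\<close>. So a support function of the zonoid is an integral
  against the measure, and at a fixed \<open>u\<close> its value for the empirical measure is an average of
  independent copies of the integrable variable \<open>max 0 (x \<bullet> u)\<close>. The strong law of large numbers
  gives almost sure convergence at that \<open>u\<close>, and hence simultaneously at all \<open>u\<close> in a countable dense
  set.

  The support function is Lipschitz with constant \<open>\<integral>x. norm x \<partial>\<mu>\<close>, and by the strong law for the norms
  these constants stay bounded along the empirical measures. Equicontinuity upgrades convergence on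
  the dense set to uniform convergence on the unit sphere, which bounds the Hausdorff distance of
  the convex sets (\<open>zonoid_tendsto\<close>). The passage from support functions to sets projects onto the
  closure of a zonoid, at the cost of an arbitrarily small enlargement of the radius.

  The strong law for integrable variables (\<open>strong_law_of_large_numbers\<close>) is obtained by truncation.
  For bounded variables Hoeffding's inequality gives deviation probabilities that are summable in
  the number of variables, and the Borel-Cantelli lemma applies. The truncation error has small
  mean, and the maximal inequality \<open>prob_average_exceeds_le\<close> turns this into a bound that holds for
  all its running averages at once. The maximal inequality is proved by Garsia's argument, which
  rests on the fact that a sequence of independent identically distributed variables has the same
  law as its shift.
\<close>

section \<open>Sequences of independent identically distributed variables\<close>

lemma (in prob_space) indep_vars_reindex:
  assumes X: "indep_vars M' X (f ` I)" and f: "inj_on f I"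
  shows "indep_vars (\<lambda>i. M' (f i)) (\<lambda>i. X (f i)) I"
  unfolding indep_vars_def2
proof (intro conjI ballI indep_setsI)
  let ?F = "\<lambda>i. {X i -` A \<inter> space M |A. A \<in> sets (M' i)}"
  have F: "indep_sets ?F (f ` I)" and rv: "\<And>i. i \<in> I \<Longrightarrow> random_variable (M' (f i)) (X (f i))"
    using X unfolding indep_vars_def2 by auto
  show "random_variable (M' (f i)) (X (f i))" if "i \<in> I" for i using rv that .
  show "?F (f i) \<subseteq> events" if "i \<in> I" for i using rv[OF that] by (auto intro: measurable_sets)
  fix A J assume J: "J \<noteq> {}" "J \<subseteq> I" "finite J" and A: "\<forall>j\<in>J. A j \<in> ?F (f j)"
  have inj: "inj_on f J" using f J(2) by (rule inj_on_subset)
  define A' where "A' k = A (the_inv_into J f k)" for k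
  have A': "A' (f j) = A j" if "j \<in> J" for j
    using the_inv_into_f_f[OF inj that] by (simp add: A'_def)
  have "prob (\<Inter>k\<in>f ` J. A' k) = (\<Prod>k\<in>f ` J. prob (A' k))"
    using J A by (intro indep_setsD[OF F]) (auto simp: A')
  then show "prob (\<Inter>j\<in>J. A j) = (\<Prod>j\<in>J. prob (A j))"
    by (simp add: A' prod.reindex[OF inj])
qed

locale iid_sequence = prob_space +
  fixes X :: "nat \<Rightarrow> 'a \<Rightarrow> 'b::second_countable_topology"
  assumes indep: "indep_vars (\<lambda>_. borel) X UNIV"
    and identically_distributed: "distr M borel (X i) = distr M borel (X 0)"
begin

lemma measurable_X [measurable]: "X i \<in> borel_measurable M"
  using indep unfolding indep_vars_def by blast

lemma iid_sequence_compose: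
  fixes f :: "'b \<Rightarrow> 'c::second_countable_topology"
  assumes [measurable]: "f \<in> borel_measurable borel"
  shows "iid_sequence M (\<lambda>i \<omega>. f (X i \<omega>))"
proof unfold_locales
  show "indep_vars (\<lambda>_. borel) (\<lambda>i \<omega>. f (X i \<omega>)) UNIV"
    by (rule indep_vars_compose2[OF indep]) simp
  have "distr M borel (\<lambda>\<omega>. f (X i \<omega>)) = distr (distr M borel (X i)) borel f" for i
    by (subst distr_distr) (auto simp: comp_def)
  then show "distr M borel (\<lambda>\<omega>. f (X i \<omega>)) = distr M borel (\<lambda>\<omega>. f (X 0 \<omega>))" for i
    by (simp only: identically_distributed[of i])
qed

lemma integrable_compose_iff:
  fixes f :: "'b \<Rightarrow> real"
  assumes [measurable]: "f \<in> borel_measurable borel"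
  shows "integrable M (\<lambda>\<omega>. f (X i \<omega>)) \<longleftrightarrow> integrable M (\<lambda>\<omega>. f (X 0 \<omega>))"
  using integrable_distr_eq[of "X i" M borel f] integrable_distr_eq[of "X 0" M borel f]
  by (simp add: identically_distributed[of i])

text \<open>
  Stationarity: as random sequences, both sides are distributed as the infinite product of the
  common law of the variables.
\<close>

lemma distr_process_shift:
  "distr M (\<Pi>\<^sub>M i\<in>UNIV. borel) (\<lambda>\<omega> i. X (Suc i) \<omega>) = distr M (\<Pi>\<^sub>M i\<in>UNIV. borel) (\<lambda>\<omega> i. X i \<omega>)"
proof -
  have "indep_vars (\<lambda>_. borel) (\<lambda>i. X (Suc i)) UNIV"
    using indep_vars_reindex[OF indep_vars_subset[OF indep, of "range Suc"]] by simp
  then have "distr M (\<Pi>\<^sub>M i\<in>UNIV. borel) (\<lambda>\<omega> i. X (Suc i) \<omega>) = (\<Pi>\<^sub>M i\<in>UNIV. distr M borel (X (Suc i)))"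
    by (subst (asm) indep_vars_iff_distr_eq_PiM) (auto simp: restrict_def)
  also have "\<dots> = (\<Pi>\<^sub>M i\<in>UNIV. distr M borel (X i))"
    using trans[OF identically_distributed identically_distributed[symmetric]]
    by (intro PiM_cong) auto
  also have "\<dots> = distr M (\<Pi>\<^sub>M i\<in>UNIV. borel) (\<lambda>\<omega> i. X i \<omega>)"
    using indep by (subst (asm) indep_vars_iff_distr_eq_PiM) (auto simp: restrict_def)
  finally show ?thesis .
qed

end

section \<open>A maximal inequality for partial sums\<close>

text \<open>
  This is \<open>Max {\<Sum>i<k. x i | k. k \<le> n}\<close>, the empty sum included. The recursion over the shifted
  sequence is the form in which Garsia's argument uses it.
\<close>

primrec max_partial_sum :: "nat \<Rightarrow> (nat \<Rightarrow> real) \<Rightarrow> real" where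
  "max_partial_sum 0 x = 0"
| "max_partial_sum (Suc n) x = max 0 (x 0 + max_partial_sum n (\<lambda>i. x (Suc i)))"

lemma sum_le_max_partial_sum: "k \<le> n \<Longrightarrow> (\<Sum>i<k. x i) \<le> max_partial_sum n x"
proof (induction n arbitrary: k x)
  case (Suc n)
  show ?case
  proof (cases k)
    case (Suc j)
    have "(\<Sum>i<k. x i) = x 0 + (\<Sum>i<j. x (Suc i))"
      unfolding Suc by (rule sum.lessThan_Suc_shift)
    also have "\<dots> \<le> x 0 + max_partial_sum n (\<lambda>i. x (Suc i))"
      using Suc.prems Suc by (intro add_left_mono Suc.IH) simp
    finally show ?thesis by simp
  qed simp
qed simp

lemma max_partial_sum_nonneg: "0 \<le> max_partial_sum n x"
  by (cases n) auto

lemma max_partial_sum_le: "max_partial_sum n x \<le> (\<Sum>i<n. \<bar>x i\<bar>)"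
proof (induction n arbitrary: x)
  case (Suc n)
  have "x 0 + max_partial_sum n (\<lambda>i. x (Suc i)) \<le> \<bar>x 0\<bar> + (\<Sum>i<n. \<bar>x (Suc i)\<bar>)"
    by (intro add_mono Suc.IH) simp
  then show ?case
    by (simp add: sum.lessThan_Suc_shift sum_nonneg del: sum.lessThan_Suc)
qed simp

lemma max_partial_sum_mono: "max_partial_sum n x \<le> max_partial_sum (Suc n) x"
proof (induction n arbitrary: x)
  case (Suc n)
  from Suc.IH[of "\<lambda>i. x (Suc i)"] show ?case
    by (auto simp: max_def)
qed simp

lemma measurable_max_partial_sum [measurable]:
  "max_partial_sum n \<in> borel_measurable (\<Pi>\<^sub>M i\<in>UNIV. borel)"
proof (induction n)
  case (Suc n)
  have "(\<lambda>x i. x (Suc i)) \<in> measurable (\<Pi>\<^sub>M i\<in>UNIV. borel) (\<Pi>\<^sub>M i\<in>(UNIV::nat set). (borel::real measure))"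
    by (rule measurable_PiM_single') auto
  note [measurable] = measurable_compose[OF this Suc]
  show ?case unfolding max_partial_sum.simps by measurable
qed simp

text \<open>
  Let \<open>n = Suc m\<close>, let \<open>G k\<close> be the maximal partial sum up to length \<open>k\<close> of the sequence, and \<open>H\<close>
  that up to length \<open>m\<close> of the shifted sequence. On the event that \<open>G (Suc m)\<close> is positive, the
  recursion reads \<open>G (Suc m) = V 0 + H\<close>;
  off this event \<open>G (Suc m) - H \<le> 0\<close>. So the integral in question is at least the expectation of
  \<open>G (Suc m) - H\<close>. By stationarity \<open>H\<close> has the same expectation as \<open>G m\<close>, which is at most
  \<open>G (Suc m)\<close>.
\<close>

lemma Garsia_maximal_inequality:
  fixes V :: "nat \<Rightarrow> 'a \<Rightarrow> real"
  assumes V: "iid_sequence M V" and int: "integrable M (V 0)"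
  shows "0 \<le> (\<integral>\<omega>. (if 0 < max_partial_sum n (\<lambda>i. V i \<omega>) then V 0 \<omega> else 0) \<partial>M)"
proof (cases n)
  case (Suc m)
  interpret iid_sequence M V by fact
  define G where "G k \<omega> = max_partial_sum k (\<lambda>i. V i \<omega>)" for k \<omega>
  define H where "H \<omega> = max_partial_sum m (\<lambda>i. V (Suc i) \<omega>)" for \<omega>
  have path [measurable]: "(\<lambda>\<omega> i. V i \<omega>) \<in> measurable M (\<Pi>\<^sub>M i\<in>UNIV. borel)"
    "(\<lambda>\<omega> i. V (Suc i) \<omega>) \<in> measurable M (\<Pi>\<^sub>M i\<in>UNIV. borel)"
    by (auto intro!: measurable_PiM_single')
  have meas [measurable]: "G k \<in> borel_measurable M" "H \<in> borel_measurable M" for k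
    unfolding G_def H_def by (rule measurable_compose[OF path(1) measurable_max_partial_sum]
      measurable_compose[OF path(2) measurable_max_partial_sum])+
  have V_int: "integrable M (V i)" for i
    using integrable_compose_iff[of "\<lambda>x. x" i] int by simp
  have G_int: "integrable M (G k)" for k
  proof (rule Bochner_Integration.integrable_bound)
    show "integrable M (\<lambda>\<omega>. \<Sum>i<k. \<bar>V i \<omega>\<bar>)" using V_int by simp
    show "AE \<omega> in M. norm (G k \<omega>) \<le> norm (\<Sum>i<k. \<bar>V i \<omega>\<bar>)"
    proof (rule AE_I2)
      show "norm (G k \<omega>) \<le> norm (\<Sum>i<k. \<bar>V i \<omega>\<bar>)" for \<omega>
        using max_partial_sum_le[of k "\<lambda>i. V i \<omega>"] max_partial_sum_nonneg[of k "\<lambda>i. V i \<omega>"]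
        by (simp add: G_def)
    qed
  qed measurable
  have H_int: "integrable M H"
  proof (rule Bochner_Integration.integrable_bound)
    show "integrable M (\<lambda>\<omega>. \<Sum>i<m. \<bar>V (Suc i) \<omega>\<bar>)" using V_int by simp
    show "AE \<omega> in M. norm (H \<omega>) \<le> norm (\<Sum>i<m. \<bar>V (Suc i) \<omega>\<bar>)"
    proof (rule AE_I2)
      show "norm (H \<omega>) \<le> norm (\<Sum>i<m. \<bar>V (Suc i) \<omega>\<bar>)" for \<omega>
        using max_partial_sum_le[of m "\<lambda>i. V (Suc i) \<omega>"] max_partial_sum_nonneg[of m "\<lambda>i. V (Suc i) \<omega>"]
        by (simp add: H_def)
    qed
  qed measurable
  have "expectation H = (\<integral>x. max_partial_sum m x \<partial>distr M (\<Pi>\<^sub>M i\<in>UNIV. borel) (\<lambda>\<omega> i. V (Suc i) \<omega>))"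
    unfolding H_def by (rule integral_distr[symmetric]) measurable
  also have "\<dots> = expectation (G m)"
    unfolding distr_process_shift G_def by (rule integral_distr) measurable
  finally have HG: "expectation H = expectation (G m)" .
  have "0 \<le> expectation (\<lambda>\<omega>. G (Suc m) \<omega> - H \<omega>)"
  proof -
    have "expectation (G m) \<le> expectation (G (Suc m))"
      by (intro integral_mono G_int) (simp add: G_def max_partial_sum_mono del: max_partial_sum.simps)
    then show ?thesis using HG G_int[of "Suc m"] H_int by simp
  qed
  also have "\<dots> \<le> expectation (\<lambda>\<omega>. if 0 < G (Suc m) \<omega> then V 0 \<omega> else 0)"
  proof (rule integral_mono)
    show "integrable M (\<lambda>\<omega>. if 0 < G (Suc m) \<omega> then V 0 \<omega> else 0)"
      by (rule Bochner_Integration.integrable_bound[OF int]) auto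
    show "G (Suc m) \<omega> - H \<omega> \<le> (if 0 < G (Suc m) \<omega> then V 0 \<omega> else 0)" for \<omega>
      using max_partial_sum_nonneg[of m "\<lambda>i. V (Suc i) \<omega>"] by (auto simp: G_def H_def)
  qed (use G_int H_int in auto)
  finally show ?thesis unfolding G_def Suc .
qed simp

text \<open>
  A version of Markov's inequality for all running averages simultaneously: apply Garsia's
  inequality to \<open>V i = W i - e\<close>. If some average of \<open>W\<close> exceeds \<open>e\<close>, then some partial sum of \<open>V\<close>
  is positive.
\<close>

lemma prob_average_exceeds_le:
  fixes W :: "nat \<Rightarrow> 'a \<Rightarrow> real"
  assumes W: "iid_sequence M W" and int: "integrable M (W 0)" and nn: "\<And>\<omega>. 0 \<le> W 0 \<omega>" and e: "0 < e"
  shows "measure M {\<omega> \<in> space M. \<exists>n. real n * e < (\<Sum>i<n. W i \<omega>)} \<le> (\<integral>\<omega>. W 0 \<omega> \<partial>M) / e"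
proof -
  interpret iid_sequence M W by fact
  define V where "V i \<omega> = W i \<omega> - e" for i \<omega>
  have V: "iid_sequence M V"
    unfolding V_def by (rule iid_sequence_compose) simp
  interpret V: iid_sequence M V by fact
  have V_int: "integrable M (V 0)"
    using int by (simp add: V_def[abs_def])
  define A where "A n = {\<omega> \<in> space M. 0 < max_partial_sum n (\<lambda>i. V i \<omega>)}" for n
  have "(\<lambda>\<omega> i. V i \<omega>) \<in> measurable M (\<Pi>\<^sub>M i\<in>UNIV. borel)"
    by (auto intro!: measurable_PiM_single')
  note [measurable] = measurable_compose[OF this measurable_max_partial_sum]
  have A [measurable]: "A n \<in> sets M" for n
    unfolding A_def by measurable
  have bound: "prob (A n) \<le> expectation (W 0) / e" for n
  proof -
    have "0 \<le> (\<integral>\<omega>. (if 0 < max_partial_sum n (\<lambda>i. V i \<omega>) then V 0 \<omega> else 0) \<partial>M)"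
      by (intro Garsia_maximal_inequality V V_int)
    also have "\<dots> \<le> (\<integral>\<omega>. W 0 \<omega> - e * indicator (A n) \<omega> \<partial>M)"
    proof (rule integral_mono)
      show "integrable M (\<lambda>\<omega>. if 0 < max_partial_sum n (\<lambda>i. V i \<omega>) then V 0 \<omega> else 0)"
        by (rule Bochner_Integration.integrable_bound[OF V_int]) auto
      show "integrable M (\<lambda>\<omega>. W 0 \<omega> - e * indicator (A n) \<omega>)"
        using int by (auto simp: emeasure_eq_measure)
      show "(if 0 < max_partial_sum n (\<lambda>i. V i \<omega>) then V 0 \<omega> else 0) \<le> W 0 \<omega> - e * indicator (A n) \<omega>"
        if "\<omega> \<in> space M" for \<omega>
        using that nn[of \<omega>] by (auto simp: A_def V_def[of 0])
    qed
    also have "\<dots> = expectation (W 0) - e * prob (A n)"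
      using int by (subst Bochner_Integration.integral_diff) (auto simp: emeasure_eq_measure)
    finally show ?thesis using e by (simp add: field_simps)
  qed
  have "incseq A"
    unfolding A_def using max_partial_sum_mono
    by (intro incseq_SucI) (auto intro: less_le_trans simp del: max_partial_sum.simps)
  then have "(\<lambda>n. prob (A n)) \<longlonglongrightarrow> prob (\<Union>n. A n)"
    by (intro finite_Lim_measure_incseq) auto
  then have "prob (\<Union>n. A n) \<le> expectation (W 0) / e"
    by (rule LIMSEQ_le_const2) (use bound in auto)
  moreover have "prob {\<omega> \<in> space M. \<exists>n. real n * e < (\<Sum>i<n. W i \<omega>)} \<le> prob (\<Union>n. A n)"
  proof (rule finite_measure_mono, safe)
    fix \<omega> n assume "\<omega> \<in> space M" "real n * e < (\<Sum>i<n. W i \<omega>)"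
    then have "0 < (\<Sum>i<n. V i \<omega>)" "\<omega> \<in> space M"
      by (simp_all add: V_def sum_subtractf)
    then show "\<omega> \<in> (\<Union>n. A n)"
      using sum_le_max_partial_sum[of n n "\<lambda>i. V i \<omega>"] by (auto simp: A_def intro: less_le_trans)
  qed measurable
  ultimately show ?thesis by linarith
qed

section \<open>The strong law of large numbers\<close>

text \<open>Hoeffding's bound on the deviation of the average is a geometric sequence in \<open>n\<close>.\<close>

lemma strong_law_bounded:
  fixes Y :: "nat \<Rightarrow> 'a \<Rightarrow> real"
  assumes Y: "iid_sequence M Y" and bdd: "\<And>\<omega>. \<bar>Y 0 \<omega>\<bar> \<le> b"
  shows "AE \<omega> in M. (\<lambda>n. (\<Sum>i<n. Y i \<omega>) / n) \<longlonglongrightarrow> (\<integral>\<omega>. Y 0 \<omega> \<partial>M)"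
proof -
  interpret iid_sequence M Y by fact
  (* The interval in Hoeffding's inequality must have positive length, also if b = 0. *)
  define c where "c = max b 1"
  have c: "-c < c" by (simp add: c_def)
  have dev: "AE \<omega> in M. eventually (\<lambda>n. \<bar>(\<Sum>i<n. Y i \<omega>) / n - expectation (Y 0)\<bar> < e) sequentially"
    if e: "0 < e" for e
  proof -
    define A where "A n = {\<omega> \<in> space M. e \<le> \<bar>(\<Sum>i<n. Y i \<omega>) / n - expectation (Y 0)\<bar>}" for n
    define q where "q = exp (-2 * e\<^sup>2 / (c - (-c))\<^sup>2)"
    have [measurable]: "A n \<in> sets M" for n unfolding A_def by measurable
    have le: "prob (A n) \<le> 2 * q ^ n" for n
    proof (cases "n = 0")
      case False
      have H: "Hoeffding_ineq_iid M {..<n} Y (Y 0) (-c) c"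
        unfolding Hoeffding_ineq_iid_def
      proof unfold_locales
        show "indep_vars (\<lambda>_. borel) Y {..<n}" by (rule indep_vars_subset[OF indep]) auto
        show "AE x in M. Y 0 x \<in> {- c..c}"
        proof (rule AE_I2)
          show "Y 0 x \<in> {- c..c}" for x
            using bdd[of x] unfolding c_def by (auto simp: abs_le_iff)
        qed
        show "distr M borel (Y i) = distr M borel (Y 0)" for i
          by (rule identically_distributed)
        show "Y 0 \<in> borel_measurable M" by (rule measurable_X)
      qed (rule finite_lessThan)
      have "prob (A n) \<le> 2 * exp (-2 * n * e\<^sup>2 / (c - (-c))\<^sup>2)"
        using Hoeffding_ineq_iid.Hoeffding_ineq_abs_ge'[OF H, of e] e c False
        unfolding A_def card_lessThan by (simp add: lessThan_empty_iff)
      also have "exp (-2 * n * e\<^sup>2 / (c - (-c))\<^sup>2) = q ^ n"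
        unfolding q_def by (simp add: exp_of_nat_mult[symmetric] mult_ac)
      finally show ?thesis .
    next
      case True
      have "prob (A n) \<le> 1" by (rule prob_le_1)
      also have "1 \<le> 2 * q ^ n" using True by simp
      finally show ?thesis .
    qed
    have "q < 1" "0 < q" using e c by (auto simp: q_def)
    then have "summable (\<lambda>n. 2 * q ^ n)" by (intro summable_mult summable_geometric) simp
    then have "summable (\<lambda>n. prob (A n))"
      by (rule summable_comparison_test') (use le in auto)
    then have "AE \<omega> in M. eventually (\<lambda>n. \<omega> \<in> space M - A n) sequentially"
      by (intro borel_cantelli_AE1) (auto simp: emeasure_eq_measure)
    then show ?thesis
      by eventually_elim (auto simp: A_def elim!: eventually_mono)
  qed
  have "AE \<omega> in M. \<forall>k. eventually (\<lambda>n. \<bar>(\<Sum>i<n. Y i \<omega>) / n - expectation (Y 0)\<bar> < 1 / real (Suc k)) sequentially"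
    by (subst AE_all_countable) (auto intro: dev)
  then show ?thesis
  proof eventually_elim
    case (elim \<omega>)
    show ?case
    proof (rule tendstoI)
      fix e :: real assume "0 < e"
      then obtain k where "1 / real (Suc k) < e" using nat_approx_posE by blast
      with elim[rule_format, of k] show "\<forall>\<^sub>F n in sequentially. dist ((\<Sum>i<n. Y i \<omega>) / n) (expectation (Y 0)) < e"
        by (auto simp: dist_real_def elim!: eventually_mono)
    qed
  qed
qed

definition clamp_real :: "real \<Rightarrow> real \<Rightarrow> real" where
  "clamp_real b y = max (-b) (min b y)"

lemma measurable_clamp_real [measurable]: "clamp_real b \<in> borel_measurable borel"
  unfolding clamp_real_def by measurable

text \<open>
  For a fixed truncation level the maximal inequality leaves an exceptional set of measure at most
  the mean truncation error divided by \<open>e\<close>. This tends to 0 as the level grows, so almost every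
  \<open>\<omega>\<close> admits a level, depending on \<open>\<omega>\<close>, at which all running averages of the error are at most \<open>e\<close>.
\<close>

lemma small_truncation_error:
  fixes Y :: "nat \<Rightarrow> 'a \<Rightarrow> real"
  assumes Y: "iid_sequence M Y" and int: "integrable M (Y 0)" and e: "0 < e"
  shows "AE \<omega> in M. \<exists>m. (\<integral>\<omega>. \<bar>Y 0 \<omega> - clamp_real (real m) (Y 0 \<omega>)\<bar> \<partial>M) \<le> e \<and>
    (\<forall>n. (\<Sum>i<n. \<bar>Y i \<omega> - clamp_real (real m) (Y i \<omega>)\<bar>) \<le> real n * e)"
proof -
  interpret iid_sequence M Y by fact
  define W where "W m i \<omega> = \<bar>Y i \<omega> - clamp_real (real m) (Y i \<omega>)\<bar>" for m i \<omega>
  define B where "B m = {\<omega> \<in> space M. \<exists>n. real n * e < (\<Sum>i<n. W m i \<omega>)}" for m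
  have W: "iid_sequence M (W m)" for m
    unfolding W_def by (rule iid_sequence_compose) measurable
  have [measurable]: "W m i \<in> borel_measurable M" for m i
    unfolding W_def by measurable
  have B [measurable]: "B m \<in> sets M" for m
    unfolding B_def by measurable
  have W_le: "\<bar>W m 0 \<omega>\<bar> \<le> \<bar>Y 0 \<omega>\<bar>" for m \<omega>
    by (auto simp: W_def clamp_real_def)
  have W_int: "integrable M (W m 0)" for m
    by (rule Bochner_Integration.integrable_bound[OF int]) (use W_le in auto)
  have lim: "(\<lambda>m. expectation (W m 0)) \<longlonglongrightarrow> (\<integral>\<omega>. 0 \<partial>M)"
  proof (rule integral_dominated_convergence[where w = "\<lambda>\<omega>. \<bar>Y 0 \<omega>\<bar>"])
    show "AE \<omega> in M. (\<lambda>m. W m 0 \<omega>) \<longlonglongrightarrow> 0"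
    proof (rule AE_I2)
      fix \<omega>
      obtain m0 where "\<bar>Y 0 \<omega>\<bar> \<le> real m0" using real_arch_simple by blast
      then have "W m 0 \<omega> = 0" if "m0 \<le> m" for m
        using that by (auto simp: W_def clamp_real_def)
      then show "(\<lambda>m. W m 0 \<omega>) \<longlonglongrightarrow> 0"
        by (intro tendsto_eventually) (auto simp: eventually_sequentially)
    qed
  qed (use int W_le in auto)
  from order_tendstoD(2)[OF lim, of e] have "eventually (\<lambda>m. expectation (W m 0) < e) sequentially"
    using e by simp
  then have "eventually (\<lambda>m. expectation (W m 0) \<le> e) sequentially"
    by (rule eventually_mono) simp
  then obtain m0 where m0: "\<And>m. m0 \<le> m \<Longrightarrow> expectation (W m 0) \<le> e"
    by (auto simp: eventually_sequentially)
  (* Only levels from m0 on are used, so that the level found for \<omega> also has small mean error. *)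
  have "prob (\<Inter>m\<in>{m0..}. B m) \<le> 0"
  proof (rule LIMSEQ_le_const)
    show "(\<lambda>m. expectation (W m 0) / e) \<longlonglongrightarrow> 0"
      using tendsto_divide[OF lim tendsto_const, of e] e by simp
    have "prob (\<Inter>m\<in>{m0..}. B m) \<le> expectation (W m 0) / e" if "m0 \<le> m" for m
    proof -
      have "prob (\<Inter>m\<in>{m0..}. B m) \<le> prob (B m)"
        using that by (intro finite_measure_mono) auto
      also have "\<dots> \<le> expectation (W m 0) / e"
        unfolding B_def by (rule prob_average_exceeds_le[OF W W_int _ e]) (simp add: W_def)
      finally show ?thesis .
    qed
    then show "\<exists>N. \<forall>m\<ge>N. prob (\<Inter>m\<in>{m0..}. B m) \<le> expectation (W m 0) / e" by blast
  qed
  then have "AE \<omega> in M. \<omega> \<notin> (\<Inter>m\<in>{m0..}. B m)"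
    by (intro AE_not_in) (auto simp: null_sets_def emeasure_eq_measure measure_le_0_iff)
  then show ?thesis
  proof (rule AE_mp, intro AE_I2 impI)
    fix \<omega> assume "\<omega> \<in> space M" "\<omega> \<notin> (\<Inter>m\<in>{m0..}. B m)"
    then obtain m where "m0 \<le> m" "\<forall>n. (\<Sum>i<n. W m i \<omega>) \<le> real n * e"
      by (auto simp: B_def not_less)
    then show "\<exists>m. (\<integral>\<omega>. \<bar>Y 0 \<omega> - clamp_real (real m) (Y 0 \<omega>)\<bar> \<partial>M) \<le> e \<and>
        (\<forall>n. (\<Sum>i<n. \<bar>Y i \<omega> - clamp_real (real m) (Y i \<omega>)\<bar>) \<le> real n * e)"
      using m0 unfolding W_def by blast
  qed
qed

theorem strong_law_of_large_numbers:
  fixes Y :: "nat \<Rightarrow> 'a \<Rightarrow> real"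
  assumes Y: "iid_sequence M Y" and int: "integrable M (Y 0)"
  shows "AE \<omega> in M. (\<lambda>n. (\<Sum>i<n. Y i \<omega>) / n) \<longlonglongrightarrow> (\<integral>\<omega>. Y 0 \<omega> \<partial>M)"
proof -
  interpret iid_sequence M Y by fact
  define T where "T m i \<omega> = clamp_real (real m) (Y i \<omega>)" for m i \<omega>
  have [measurable]: "T m i \<in> borel_measurable M" for m i
    unfolding T_def by measurable
  have T_bdd: "\<bar>T m i \<omega>\<bar> \<le> real m" for m i \<omega>
    by (auto simp: T_def clamp_real_def)
  have T_int: "integrable M (T m 0)" for m
    using T_bdd by (intro integrable_const_bound[of _ "real m"]) auto
  have "iid_sequence M (T m)" for m
    unfolding T_def by (rule iid_sequence_compose) measurable
  then have bounded_law: "AE \<omega> in M. \<forall>m. (\<lambda>n. (\<Sum>i<n. T m i \<omega>) / n) \<longlonglongrightarrow> expectation (T m 0)"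
    by (subst AE_all_countable) (auto intro: strong_law_bounded T_bdd)
  have "AE \<omega> in M. \<forall>k. \<exists>m. expectation (\<lambda>\<omega>. \<bar>Y 0 \<omega> - T m 0 \<omega>\<bar>) \<le> 1 / real (Suc k) \<and>
    (\<forall>n. (\<Sum>i<n. \<bar>Y i \<omega> - T m i \<omega>\<bar>) \<le> real n * (1 / real (Suc k)))"
    unfolding T_def by (subst AE_all_countable) (intro allI small_truncation_error Y int, simp)
  with bounded_law show ?thesis
  proof eventually_elim
    case (elim \<omega>)
    show ?case
    proof (rule tendstoI)
      fix e :: real assume "0 < e"
      then obtain k where k: "1 / real (Suc k) < e / 3"
        using nat_approx_posE[of "e / 3"] by auto
      define d where "d = 1 / real (Suc k)"
      obtain m where m: "expectation (\<lambda>\<omega>. \<bar>Y 0 \<omega> - T m 0 \<omega>\<bar>) \<le> d"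
        and sums: "\<And>n. (\<Sum>i<n. \<bar>Y i \<omega> - T m i \<omega>\<bar>) \<le> real n * d"
        using elim(2) unfolding d_def by blast
      have mean: "\<bar>expectation (Y 0) - expectation (T m 0)\<bar> \<le> d"
        using integral_abs_bound[of M "\<lambda>\<omega>. Y 0 \<omega> - T m 0 \<omega>"] m int T_int by simp
      have average: "\<bar>(\<Sum>i<n. Y i \<omega>) / n - (\<Sum>i<n. T m i \<omega>) / n\<bar> \<le> d" if "n > 0" for n
      proof -
        have "\<bar>(\<Sum>i<n. Y i \<omega>) - (\<Sum>i<n. T m i \<omega>)\<bar> \<le> real n * d"
          using sums[of n] sum_abs[of "\<lambda>i. Y i \<omega> - T m i \<omega>" "{..<n}"] by (simp add: sum_subtractf)
        then show ?thesis
          using that by (simp add: diff_divide_distrib[symmetric] pos_divide_le_eq mult.commute)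
      qed
      have "eventually (\<lambda>n. \<bar>(\<Sum>i<n. T m i \<omega>) / n - expectation (T m 0)\<bar> < d) sequentially"
        using tendstoD[OF elim(1)[rule_format, of m], of d] by (simp add: dist_real_def d_def)
      then show "\<forall>\<^sub>F n in sequentially. dist ((\<Sum>i<n. Y i \<omega>) / n) (expectation (Y 0)) < e"
        using eventually_gt_at_top[of 0]
      proof eventually_elim
        case (elim n)
        from mean average[OF elim(2)] elim(1) k show ?case
          unfolding d_def[symmetric] dist_real_def by linarith
      qed
    qed
  qed
qed

section \<open>Support functions of zonoids\<close>

text \<open>
  A point \<open>x\<close> of \<open>K\<close> and its nearest point \<open>p\<close> in the closure of \<open>L\<close> determine the direction
  \<open>u = (x - p) / norm (x - p)\<close>, in which \<open>p\<close> is extremal for \<open>L\<close>. Comparison in this direction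
  gives \<open>norm (x - p) \<le> e\<close>. The margin \<open>e' - e\<close> pays for replacing \<open>p\<close> by a point of \<open>L\<close> itself.
\<close>

lemma subset_parallel_body_of_inner_le:
  fixes K L :: "'a::euclidean_space set"
  assumes L: "convex L" "L \<noteq> {}" and e: "0 \<le> e" "e < e'"
    and le: "\<And>x u. x \<in> K \<Longrightarrow> norm u = 1 \<Longrightarrow> \<exists>y\<in>L. x \<bullet> u \<le> y \<bullet> u + e"
  shows "K \<subseteq> {y + e' *\<^sub>R b | y b. y \<in> L \<and> b \<in> cball 0 1}"
proof
  fix x assume x: "x \<in> K"
  define p where "p = closest_point (closure L) x"
  have p: "p \<in> closure L"
    unfolding p_def using L by (intro closest_point_in_set) auto
  have "norm (x - p) \<le> e"
  proof (cases "x = p")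
    case False
    define u where "u = (x - p) /\<^sub>R norm (x - p)"
    have "norm u = 1" using False by (simp add: u_def)
    then obtain y where y: "y \<in> L" "x \<bullet> u \<le> y \<bullet> u + e" using le[OF x] by blast
    have "(x - p) \<bullet> (y - p) \<le> 0"
      unfolding p_def using L y closure_subset by (intro closest_point_dot) (auto simp: convex_closure)
    then have "(y - p) \<bullet> u \<le> 0"
      using False by (simp add: u_def inner_commute mult_le_0_iff)
    moreover have "(x - p) \<bullet> u = norm (x - p)"
      using False by (simp add: u_def dot_square_norm power2_eq_square)
    ultimately show ?thesis using y by (simp add: inner_diff_left)
  qed (use e in simp)
  moreover obtain y where y: "y \<in> L" "dist y p < e' - e"
    using p e by (auto simp: closure_approachable dest: spec[of _ "e' - e"])
  ultimately have "norm (x - y) \<le> e'"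
    using norm_triangle_ineq[of "x - p" "p - y"] by (simp add: dist_norm norm_minus_commute)
  then have "(x - y) /\<^sub>R e' \<in> cball 0 1" "x = y + e' *\<^sub>R ((x - y) /\<^sub>R e')"
    using e by (simp_all add: divide_simps)
  with y show "x \<in> {y + e' *\<^sub>R b | y b. y \<in> L \<and> b \<in> cball 0 1}" by blast
qed

definition zonoid_support :: "(real ^ 'n) measure \<Rightarrow> real ^ 'n \<Rightarrow> real" where
  "zonoid_support \<mu> u = (\<integral>x. max 0 (x \<bullet> u) \<partial>\<mu>)"

locale first_moment_measure =
  fixes \<mu> :: "(real ^ 'n) measure"
  assumes sets_eq [measurable_cong, simp]: "sets \<mu> = sets borel"
    and integrable_norm: "integrable \<mu> norm"
begin

lemma integrable_weighted:
  assumes [measurable]: "\<phi> \<in> borel_measurable borel" and "range \<phi> \<subseteq> {0..1::real}"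
  shows "integrable \<mu> (\<lambda>x. \<phi> x *\<^sub>R x)"
proof (rule Bochner_Integration.integrable_bound[OF integrable_norm])
  show "AE x in \<mu>. norm (\<phi> x *\<^sub>R x) \<le> norm (norm x)"
  proof (rule AE_I2)
    fix x
    have "\<phi> x \<in> {0..1}" using assms(2) by blast
    then show "norm (\<phi> x *\<^sub>R x) \<le> norm (norm x)"
      by (auto intro!: mult_left_le_one_le)
  qed
qed measurable

lemma integrable_pos_part: "integrable \<mu> (\<lambda>x. max 0 (x \<bullet> u))"
proof (rule Bochner_Integration.integrable_bound[of _ "\<lambda>x. norm u * norm x"])
  show "AE x in \<mu>. norm (max 0 (x \<bullet> u)) \<le> norm (norm u * norm x)"
  proof (rule AE_I2)
    fix x
    show "norm (max 0 (x \<bullet> u)) \<le> norm (norm u * norm x)"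
      using Cauchy_Schwarz_ineq2[of x u] by (auto simp: max_def abs_mult mult.commute)
  qed
qed (use integrable_norm in auto)

lemma convex_zonoid: "convex (zonoid \<mu>)"
proof (rule convexI)
  fix x y and s t :: real
  assume "x \<in> zonoid \<mu>" "y \<in> zonoid \<mu>" and st: "0 \<le> s" "0 \<le> t" "s + t = 1"
  then obtain \<phi> \<psi> where x: "x = (\<integral>x. \<phi> x *\<^sub>R x \<partial>\<mu>)" and y: "y = (\<integral>x. \<psi> x *\<^sub>R x \<partial>\<mu>)"
    and \<phi>: "\<phi> \<in> borel_measurable borel" "range \<phi> \<subseteq> {0..1::real}"
    and \<psi>: "\<psi> \<in> borel_measurable borel" "range \<psi> \<subseteq> {0..1::real}"
    unfolding zonoid_def by blast
  have "s *\<^sub>R x + t *\<^sub>R y = (\<integral>x. (s * \<phi> x + t * \<psi> x) *\<^sub>R x \<partial>\<mu>)"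
    unfolding x y using integrable_weighted[OF \<phi>] integrable_weighted[OF \<psi>]
    by (simp add: scaleR_add_left flip: scaleR_scaleR)
  moreover have "s * \<phi> z + t * \<psi> z \<in> {0..1}" for z
  proof -
    have "\<phi> z \<in> {0..1}" "\<psi> z \<in> {0..1}" using \<phi>(2) \<psi>(2) by blast+
    then show ?thesis
      using st convex_bound_le[of "\<phi> z" 1 "\<psi> z" s t] by auto
  qed
  ultimately show "s *\<^sub>R x + t *\<^sub>R y \<in> zonoid \<mu>"
    using \<phi>(1) \<psi>(1) unfolding zonoid_def
    by (intro CollectI exI[of _ "\<lambda>x. s * \<phi> x + t * \<psi> x"]) auto
qed

lemma inner_le_zonoid_support:
  assumes "z \<in> zonoid \<mu>"
  shows "z \<bullet> u \<le> zonoid_support \<mu> u"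
proof -
  obtain \<phi> where z: "z = (\<integral>x. \<phi> x *\<^sub>R x \<partial>\<mu>)"
    and \<phi>: "\<phi> \<in> borel_measurable borel" "range \<phi> \<subseteq> {0..1::real}"
    using assms unfolding zonoid_def by blast
  have "z \<bullet> u = (\<integral>x. (\<phi> x *\<^sub>R x) \<bullet> u \<partial>\<mu>)"
    unfolding z by (rule integral_inner_left[symmetric]) (rule integrable_weighted[OF \<phi>])
  also have "\<dots> \<le> (\<integral>x. max 0 (x \<bullet> u) \<partial>\<mu>)"
  proof (rule integral_mono)
    show "integrable \<mu> (\<lambda>x. (\<phi> x *\<^sub>R x) \<bullet> u)"
      using integrable_weighted[OF \<phi>] by (rule integrable_inner_left)
    show "(\<phi> x *\<^sub>R x) \<bullet> u \<le> max 0 (x \<bullet> u)" for x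
    proof -
      have "\<phi> x \<in> {0..1}" using \<phi>(2) by blast
      then show ?thesis
        by (auto simp: le_max_iff_disj mult_le_0_iff intro!: mult_left_le_one_le)
    qed
  qed (rule integrable_pos_part)
  finally show ?thesis by (simp add: zonoid_support_def)
qed

text \<open>The maximising weight keeps exactly the mass in the half-space where \<open>x \<bullet> u\<close> is positive.\<close>

lemma zonoid_support_attained: "\<exists>z\<in>zonoid \<mu>. z \<bullet> u = zonoid_support \<mu> u"
proof
  let ?\<phi> = "indicator {x. 0 < x \<bullet> u} :: real ^ 'n \<Rightarrow> real"
  have \<phi>: "?\<phi> \<in> borel_measurable borel" "range ?\<phi> \<subseteq> {0..1}"
    by (auto simp: indicator_def)
  show "(\<integral>x. ?\<phi> x *\<^sub>R x \<partial>\<mu>) \<in> zonoid \<mu>" using \<phi> unfolding zonoid_def by blast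
  have "(\<integral>x. ?\<phi> x *\<^sub>R x \<partial>\<mu>) \<bullet> u = (\<integral>x. (?\<phi> x *\<^sub>R x) \<bullet> u \<partial>\<mu>)"
    by (rule integral_inner_left[symmetric]) (rule integrable_weighted[OF \<phi>])
  also have "\<dots> = zonoid_support \<mu> u"
    unfolding zonoid_support_def by (intro Bochner_Integration.integral_cong) (auto simp: indicator_def)
  finally show "(\<integral>x. ?\<phi> x *\<^sub>R x \<partial>\<mu>) \<bullet> u = zonoid_support \<mu> u" .
qed

lemma zonoid_support_Lipschitz:
  "\<bar>zonoid_support \<mu> u - zonoid_support \<mu> v\<bar> \<le> norm (u - v) * (\<integral>x. norm x \<partial>\<mu>)"
proof -
  have "\<bar>zonoid_support \<mu> u - zonoid_support \<mu> v\<bar> = \<bar>\<integral>x. max 0 (x \<bullet> u) - max 0 (x \<bullet> v) \<partial>\<mu>\<bar>"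
    unfolding zonoid_support_def by (subst Bochner_Integration.integral_diff) (auto intro: integrable_pos_part)
  also have "\<dots> \<le> (\<integral>x. \<bar>max 0 (x \<bullet> u) - max 0 (x \<bullet> v)\<bar> \<partial>\<mu>)" by (rule integral_abs_bound)
  also have "\<dots> \<le> (\<integral>x. norm (u - v) * norm x \<partial>\<mu>)"
  proof (rule integral_mono)
    show "\<bar>max 0 (x \<bullet> u) - max 0 (x \<bullet> v)\<bar> \<le> norm (u - v) * norm x" for x
    proof -
      have "\<bar>max 0 (x \<bullet> u) - max 0 (x \<bullet> v)\<bar> \<le> \<bar>x \<bullet> (u - v)\<bar>" by (auto simp: inner_diff_right)
      also have "\<dots> \<le> norm x * norm (u - v)" by (rule Cauchy_Schwarz_ineq2)
      finally show ?thesis by (simp add: mult.commute)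
    qed
  qed (auto intro!: integrable_norm integrable_pos_part)
  finally show ?thesis by simp
qed

end

section \<open>Convergence of zonoids\<close>

lemma hausdorff_dist_zonoid_le:
  fixes \<mu> \<nu> :: "(real ^ 'n) measure"
  assumes \<mu>: "first_moment_measure \<mu>" and \<nu>: "first_moment_measure \<nu>" and e: "0 \<le> e" "e < e'"
    and close: "\<And>u. norm u = 1 \<Longrightarrow> \<bar>zonoid_support \<nu> u - zonoid_support \<mu> u\<bar> \<le> e"
  shows "\<bar>hausdorff_dist (zonoid \<nu>) (zonoid \<mu>)\<bar> \<le> e'"
proof -
  have sub: "zonoid \<alpha> \<subseteq> {y + e' *\<^sub>R b | y b. y \<in> zonoid \<beta> \<and> b \<in> cball 0 1}"
    if \<alpha>: "first_moment_measure \<alpha>" and \<beta>: "first_moment_measure \<beta>"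
      and le: "\<And>u. norm u = 1 \<Longrightarrow> zonoid_support \<alpha> u \<le> zonoid_support \<beta> u + e"
    for \<alpha> \<beta> :: "(real ^ 'n) measure"
  proof (rule subset_parallel_body_of_inner_le[OF _ _ e])
    interpret \<alpha>: first_moment_measure \<alpha> by fact
    interpret \<beta>: first_moment_measure \<beta> by fact
    show "convex (zonoid \<beta>)" "zonoid \<beta> \<noteq> {}"
      using \<beta>.convex_zonoid \<beta>.zonoid_support_attained by auto
    fix x u :: "real ^ 'n" assume x: "x \<in> zonoid \<alpha>" and u: "norm u = 1"
    obtain y where "y \<in> zonoid \<beta>" "y \<bullet> u = zonoid_support \<beta> u"
      using \<beta>.zonoid_support_attained by blast
    then show "\<exists>y\<in>zonoid \<beta>. x \<bullet> u \<le> y \<bullet> u + e"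
      using \<alpha>.inner_le_zonoid_support[OF x, of u] le[OF u] by force
  qed
  let ?E = "{\<epsilon>. 0 \<le> \<epsilon> \<and>
      zonoid \<nu> \<subseteq> {y + \<epsilon> *\<^sub>R b | y b. y \<in> zonoid \<mu> \<and> b \<in> cball 0 1} \<and>
      zonoid \<mu> \<subseteq> {y + \<epsilon> *\<^sub>R b | y b. y \<in> zonoid \<nu> \<and> b \<in> cball 0 1}}"
  have "e' \<in> ?E"
    using e sub[OF \<mu> \<nu>] sub[OF \<nu> \<mu>] close by (auto simp: abs_le_iff algebra_simps)
  moreover have "bdd_below ?E" by (rule bdd_belowI[of _ 0]) simp
  ultimately have "Inf ?E \<le> e'" "0 \<le> Inf ?E"
    by (auto intro: cInf_lower simp del: mem_Collect_eq) (auto intro!: cInf_greatest)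
  then show ?thesis unfolding hausdorff_dist_def by simp
qed

text \<open>
  An Arzela-Ascoli argument: convergence of the norm integrals makes the support functions
  uniformly Lipschitz for large \<open>N\<close>, so that their convergence at the finitely many centres of a
  cover of the sphere controls them on the whole sphere.
\<close>

lemma zonoid_tendsto:
  fixes \<mu> :: "(real ^ 'n) measure" and \<nu> :: "nat \<Rightarrow> (real ^ 'n) measure"
  assumes \<mu>: "first_moment_measure \<mu>" and \<nu>: "eventually (\<lambda>N. first_moment_measure (\<nu> N)) sequentially"
    and norms: "(\<lambda>N. \<integral>x. norm x \<partial>\<nu> N) \<longlonglongrightarrow> (\<integral>x. norm x \<partial>\<mu>)"
    and dense: "\<And>U. open U \<Longrightarrow> U \<noteq> {} \<Longrightarrow> \<exists>d\<in>D. d \<in> U"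
    and support: "\<And>d. d \<in> D \<Longrightarrow> (\<lambda>N. zonoid_support (\<nu> N) d) \<longlonglongrightarrow> zonoid_support \<mu> d"
  shows "(\<lambda>N. hausdorff_dist (zonoid (\<nu> N)) (zonoid \<mu>)) \<longlonglongrightarrow> 0"
proof (rule tendstoI)
  fix e :: real assume e: "0 < e"
  define C where "C = (\<integral>x. norm x \<partial>\<mu>) + 1"
  (* C bounds the Lipschitz constants. With radius r the oscillation over a ball is at most e / 8
     for either support function; with the error e / 4 at its centre this adds up to e / 2. *)
  define r where "r = e / (8 * C)"
  have C: "0 < C" unfolding C_def by (intro add_nonneg_pos Bochner_Integration.integral_nonneg) auto
  then have r: "0 < r" "r * C = e / 8" using e by (auto simp: r_def)
  have cover: "sphere (0::real ^ 'n) 1 \<subseteq> (\<Union>d\<in>D. ball d r)"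
  proof
    fix u :: "real ^ 'n"
    obtain d where "d \<in> D" "d \<in> ball u r" using dense[of "ball u r"] r by auto
    then show "u \<in> (\<Union>d\<in>D. ball d r)" by (auto simp: dist_commute)
  qed
  obtain F where F: "F \<subseteq> D" "finite F" "sphere 0 1 \<subseteq> (\<Union>d\<in>F. ball d r)"
    by (rule compactE_image[OF compact_sphere _ cover]) auto
  have "eventually (\<lambda>N. \<forall>d\<in>F. dist (zonoid_support (\<nu> N) d) (zonoid_support \<mu> d) < e / 4) sequentially"
    using F e by (intro eventually_ball_finite ballI tendstoD support) auto
  moreover have "eventually (\<lambda>N. (\<integral>x. norm x \<partial>\<nu> N) < C) sequentially"
    by (rule order_tendstoD(2)[OF norms]) (simp add: C_def)
  ultimately show "eventually (\<lambda>N. dist (hausdorff_dist (zonoid (\<nu> N)) (zonoid \<mu>)) 0 < e) sequentially"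
    using \<nu>
  proof eventually_elim
    case (elim N)
    have "\<bar>zonoid_support (\<nu> N) u - zonoid_support \<mu> u\<bar> \<le> e / 2" if u: "norm u = 1" for u
    proof -
      obtain d where d: "d \<in> F" "u \<in> ball d r" using subsetD[OF F(3), of u] u by auto
      then have ud: "norm (u - d) \<le> r" by (simp add: dist_norm norm_minus_commute)
      have Lip: "\<bar>zonoid_support \<alpha> u - zonoid_support \<alpha> d\<bar> \<le> e / 8"
        if "first_moment_measure \<alpha>" "(\<integral>x. norm x \<partial>\<alpha>) \<le> C" for \<alpha>
      proof -
        have "\<bar>zonoid_support \<alpha> u - zonoid_support \<alpha> d\<bar> \<le> norm (u - d) * (\<integral>x. norm x \<partial>\<alpha>)"
          by (rule first_moment_measure.zonoid_support_Lipschitz) fact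
        also have "\<dots> \<le> r * C" using ud that r by (intro mult_mono) auto
        finally show ?thesis by (simp add: r)
      qed
      have "\<bar>zonoid_support (\<nu> N) d - zonoid_support \<mu> d\<bar> < e / 4"
        using elim d by (auto simp: dist_real_def)
      moreover have "\<bar>zonoid_support (\<nu> N) u - zonoid_support (\<nu> N) d\<bar> \<le> e / 8"
        using elim by (intro Lip) auto
      moreover have "\<bar>zonoid_support \<mu> u - zonoid_support \<mu> d\<bar> \<le> e / 8"
        using \<mu> by (intro Lip) (auto simp: C_def)
      ultimately show ?thesis by linarith
    qed
    then have "\<bar>hausdorff_dist (zonoid (\<nu> N)) (zonoid \<mu>)\<bar> \<le> 3 * e / 4"
      using e elim by (intro hausdorff_dist_zonoid_le[OF \<mu>, of _ "e / 2"]) auto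
    then show ?case using e by (simp add: dist_real_def)
  qed
qed

section \<open>Empirical measures\<close>

text \<open>
  The empirical measure is the law of \<open>x i\<close> for an index \<open>i\<close> chosen uniformly from \<open>{1..N}\<close>; this
  reduces its integrals to finite sums. For \<open>N = 0\<close> it is the zero measure, and no such index exists.
\<close>

lemma empirical_measure_eq_distr:
  assumes "1 \<le> N"
  shows "empirical_measure x N = distr (measure_pmf (pmf_of_set {1..N})) borel x"
proof (rule measure_eqI)
  fix A assume "A \<in> sets (empirical_measure x N)"
  then have A: "A \<in> sets borel" by simp
  have "emeasure (empirical_measure x N) A = ennreal (1 / real N) * (\<Sum>i\<in>{1..N}. indicator A (x i))"
    using A by (simp add: emeasure_empirical_measure)
  also have "(\<Sum>i\<in>{1..N}. indicator A (x i) :: ennreal) = of_nat (card ({1..N} \<inter> x -` A))"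
    by (simp add: indicator_def sum.If_cases Int_def vimage_def)
  also have "ennreal (1 / real N) * \<dots> = emeasure (distr (measure_pmf (pmf_of_set {1..N})) borel x) A"
    using A assms
    by (simp add: emeasure_distr emeasure_pmf_of_set ennreal_of_nat_eq_real_of_nat flip: ennreal_mult)
  finally show "emeasure (empirical_measure x N) A = \<dots>" .
qed simp

lemma integral_empirical_measure:
  fixes f :: "real ^ 'n \<Rightarrow> real"
  assumes "1 \<le> N" and [measurable]: "f \<in> borel_measurable borel"
  shows "(\<integral>y. f y \<partial>empirical_measure x N) = (\<Sum>i\<in>{1..N}. f (x i)) / N"
  using assms by (simp add: empirical_measure_eq_distr integral_distr integral_pmf_of_set)

lemma first_moment_measure_empirical:
  assumes "1 \<le> N"
  shows "first_moment_measure (empirical_measure x N)"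
  using assms by unfold_locales
    (auto simp: empirical_measure_eq_distr integrable_distr_eq intro!: integrable_measure_pmf_finite)

text \<open>The strong law of large numbers, restated for integrals against empirical measures.\<close>

lemma empirical_integral_tendsto:
  fixes \<mu> :: "(real ^ 'n) measure" and f :: "real ^ 'n \<Rightarrow> real"
  assumes X: "iid_sequence M (\<lambda>i. X (Suc i))" and \<mu>: "distr M borel (X 1) = \<mu>"
    and f [measurable]: "f \<in> borel_measurable borel" and int: "integrable \<mu> f"
  shows "AE \<omega> in M. (\<lambda>N. \<integral>x. f x \<partial>empirical_measure (\<lambda>i. X i \<omega>) N) \<longlonglongrightarrow> (\<integral>x. f x \<partial>\<mu>)"
proof -
  interpret iid_sequence M "\<lambda>i. X (Suc i)" by fact
  have [measurable]: "X (Suc 0) \<in> borel_measurable M" by (rule measurable_X)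
  have distr: "distr M borel (X (Suc 0)) = \<mu>" using \<mu> by simp
  have "integrable M (\<lambda>\<omega>. f (X (Suc 0) \<omega>))"
    using int unfolding distr[symmetric] by (simp add: integrable_distr_eq)
  then have "AE \<omega> in M. (\<lambda>N. (\<Sum>i<N. f (X (Suc i) \<omega>)) / N) \<longlonglongrightarrow> (\<integral>\<omega>. f (X (Suc 0) \<omega>) \<partial>M)"
    by (intro strong_law_of_large_numbers iid_sequence_compose f)
  also have "(\<integral>\<omega>. f (X (Suc 0) \<omega>) \<partial>M) = (\<integral>x. f x \<partial>\<mu>)"
    unfolding distr[symmetric] by (rule integral_distr[symmetric]) measurable
  finally show ?thesis
  proof eventually_elim
    case (elim \<omega>)
    have "eventually (\<lambda>N. (\<Sum>i<N. f (X (Suc i) \<omega>)) / N = (\<integral>x. f x \<partial>empirical_measure (\<lambda>i. X i \<omega>) N)) sequentially"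
      using eventually_ge_at_top[of 1]
      by eventually_elim (simp add: integral_empirical_measure sum.atLeast1_atMost_eq)
    with elim show ?case by (auto dest: Lim_transform_eventually)
  qed
qed

theorem corollary3p3:
  fixes M :: "'a measure" and \<mu> :: "(real ^ 'n) measure" and X :: "nat \<Rightarrow> 'a \<Rightarrow> real ^ 'n"
  assumes "prob_space M"
    and "\<mu> \<in> P1_plus"
    and "prob_space.indep_vars M (\<lambda>_. borel) X {1..}"
    and "\<And>i \<omega>. 1 \<le> i \<Longrightarrow> \<omega> \<in> space M \<Longrightarrow> X i \<omega> \<in> nonneg_orthant"
    and "\<And>i. 1 \<le> i \<Longrightarrow> distr M borel (X i) = \<mu>"
  shows "AE \<omega> in M.
    (\<lambda>N. hausdorff_dist (zonoid (empirical_measure (\<lambda>i. X i \<omega>) N)) (zonoid \<mu>)) \<longlonglongrightarrow> 0"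
proof -
  interpret prob_space M by fact
  have \<mu>: "first_moment_measure \<mu>"
    using assms(2) by unfold_locales (auto simp: P1_plus_def)
  interpret \<mu>: first_moment_measure \<mu> by fact
  (* The strong law is stated for sequences indexed from 0, the sample X starts at 1. *)
  have range: "Suc ` UNIV = {1..}" by (auto simp: image_iff Suc_le_eq gr0_conv_Suc)
  have "indep_vars (\<lambda>_. borel) (\<lambda>i. X (Suc i)) UNIV"
    by (rule indep_vars_reindex) (use assms(3) range in auto)
  then have iid: "iid_sequence M (\<lambda>i. X (Suc i))"
    by unfold_locales (auto simp: assms(5))
  note lln = empirical_integral_tendsto[OF iid assms(5)[OF order_refl]]
  obtain D :: "(real ^ 'n) set" where D: "countable D" "\<And>U. open U \<Longrightarrow> U \<noteq> {} \<Longrightarrow> \<exists>d\<in>D. d \<in> U"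
    using countable_dense_setE by blast
  have "AE \<omega> in M. \<forall>u\<in>D. (\<lambda>N. zonoid_support (empirical_measure (\<lambda>i. X i \<omega>) N) u) \<longlonglongrightarrow> zonoid_support \<mu> u"
    unfolding AE_ball_countable[OF D(1)] zonoid_support_def
    by (intro ballI lln \<mu>.integrable_pos_part) measurable
  moreover have "AE \<omega> in M. (\<lambda>N. \<integral>x. norm x \<partial>empirical_measure (\<lambda>i. X i \<omega>) N) \<longlonglongrightarrow> (\<integral>x. norm x \<partial>\<mu>)"
    by (intro lln \<mu>.integrable_norm) measurable
  ultimately show ?thesis
  proof eventually_elim
    case (elim \<omega>)
    show ?case
    proof (rule zonoid_tendsto[OF \<mu> _ elim(2) D(2)])
      show "eventually (\<lambda>N. first_moment_measure (empirical_measure (\<lambda>i. X i \<omega>) N)) sequentially"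
        using eventually_ge_at_top[of 1] by eventually_elim (rule first_moment_measure_empirical)
    qed (use elim(1) in auto)
  qed
qed

end
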